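(* Let $f:\mathbb{R}^\ell\times\mathbb{R}^m\to\mathbb{R}^\ell$ be $C^1$, let $\Lambda$ be a parameter shift with limits $\lambda_\pm$, and let $X$ define a stable path. With $B_n(s)=[D_xf(X(s),\Lambda(s))]^n$, there exists $N\in\mathbb{N}$ such that $\|B_n(s)\|<\frac14$ for all $s\in\mathbb{R}$ and all $n\ge N$ (Euclidean-induced matrix norm).
   Context: A parameter shift is a $C^1$ function $\Lambda:\mathbb{R}\to\mathbb{R}^m$ with $\lim_{s\to\pm\infty}\Lambda(s)=\lambda_\pm$ and $\lim_{s\to\pm\infty}\Lambda'(s)=0$. A stable path is given by $X:\mathbb{R}\to\mathbb{R}^\ell$ such that: $X(s)$ is a fixed point of $f(\cdot,\Lambda(s))$ for every $s$; $\{(s,X(s))\}$ is a connected curve; the limits $X_\pm=\lim_{s\to\pm\infty}X(s)$ exist and are fixed points of $f(\cdot,\lambda_\pm)$; and the spectral radius of $D_xf(X(s),\Lambda(s))$ is $<1$ for all $s\in\mathbb{R}\cup\{\pm\infty\}$ (with $X(\pm\infty)=X_\pm$, $\Lambda(\pm\infty)=\lambda_\pm$). *)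

theory Defs
  imports "HOL-Analysis.Analysis"
begin

text \<open>C^1 map on a finite-dimensional normed space: differentiable everywhere with
  continuous (in operator norm) Frechet derivative.\<close>
definition C1_map :: "('a::real_normed_vector \<Rightarrow> 'b::real_normed_vector) \<Rightarrow> bool" where
  "C1_map f \<longleftrightarrow> (\<forall>p. f differentiable (at p)) \<and>
     continuous_on UNIV (\<lambda>p. Blinfun (frechet_derivative f (at p)))"

text \<open>Partial derivative D_x f(x,lam) of f : R^l x R^m -> R^l, as an l x l matrix.\<close>
definition Dx :: "((real^'l) \<times> (real^'m) \<Rightarrow> real^'l) \<Rightarrow> real^'l \<Rightarrow> real^'m \<Rightarrow> real^'l^'l" where
  "Dx f x lam = matrix (\<lambda>v. frechet_derivative f (at (x, lam)) (v, 0))"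

text \<open>Spectral radius of a real square matrix: largest modulus of a complex eigenvalue.\<close>
definition cmat :: "real^'n^'n \<Rightarrow> complex^'n^'n" where
  "cmat A = (\<chi> i j. complex_of_real (A $ i $ j))"

definition spectral_radius_mat :: "real^'n^'n \<Rightarrow> real" where
  "spectral_radius_mat A = Max {cmod z | z. det (mat z - cmat A) = 0}"

text \<open>Parameter shift: C^1 curve with limits lm at -inf, lp at +inf, derivative -> 0.\<close>
definition parameter_shift :: "(real \<Rightarrow> 'm::euclidean_space) \<Rightarrow> 'm \<Rightarrow> 'm \<Rightarrow> bool" where
  "parameter_shift \<Lambda> lm lp \<longleftrightarrow>
     (\<exists>\<Lambda>'. (\<forall>s. (\<Lambda> has_vector_derivative \<Lambda>' s) (at s)) \<and> continuous_on UNIV \<Lambda>' \<and>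
        (\<Lambda> \<longlongrightarrow> lp) at_top \<and> (\<Lambda> \<longlongrightarrow> lm) at_bot \<and>
        (\<Lambda>' \<longlongrightarrow> 0) at_top \<and> (\<Lambda>' \<longlongrightarrow> 0) at_bot)"

text \<open>Stable path X for f along the parameter shift \<Lambda> (with limits lm, lp),
  with end states Xm (at -inf) and Xp (at +inf).\<close>
definition stable_path ::
  "((real^'l) \<times> (real^'m) \<Rightarrow> real^'l) \<Rightarrow> (real \<Rightarrow> real^'m) \<Rightarrow> real^'m \<Rightarrow> real^'m
     \<Rightarrow> (real \<Rightarrow> real^'l) \<Rightarrow> real^'l \<Rightarrow> real^'l \<Rightarrow> bool" where
  "stable_path f \<Lambda> lm lp X Xm Xp \<longleftrightarrow>
     (\<forall>s. f (X s, \<Lambda> s) = X s) \<and>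
     connected (range (\<lambda>s. (s, X s))) \<and>
     (X \<longlongrightarrow> Xp) at_top \<and> (X \<longlongrightarrow> Xm) at_bot \<and>
     f (Xp, lp) = Xp \<and> f (Xm, lm) = Xm \<and>
     (\<forall>s. spectral_radius_mat (Dx f (X s) (\<Lambda> s)) < 1) \<and>
     spectral_radius_mat (Dx f Xp lp) < 1 \<and>
     spectral_radius_mat (Dx f Xm lm) < 1"

end

(*
  Write A(s) = D_x f(X(s), Lambda(s)). If a matrix has spectral radius < 1, its powers tend
  to 0 (Jordan normal form), so ||A^p|| < 1 for some p. This inequality survives on a
  neighbourhood U, and writing n = p q + r gives ||B^n|| <= ||B^p||^q ||B||^r < 1/4 for all
  B in U once n is large. The path s |-> A(s) is continuous with limits A(+-oo) of spectral
  radius < 1, so it lies in finitely many such neighbourhoods and one N serves every s.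

  Continuity of X is not assumed; only its graph is connected. As 1 is not an eigenvalue of
  D_x f(X(s0), Lambda(s0)), a fixed point x of f(., Lambda(s)) close to X(s0) satisfies
  |x - X(s0)| <= C |f(X(s0), Lambda(s)) - X(s0)|, which is small for s near s0. So near s0
  the graph avoids an annulus around X(s0); being connected, it cannot get outside it.
*)

theory Submission
  imports Defs "Jordan_Normal_Form.Spectral_Radius"
begin

no_notation Matrix.vec_index (infixl "$" 100)
hide_const (open) Matrix.mat Determinant.det

fun matpow :: "'a::semiring_1^'n^'n \<Rightarrow> nat \<Rightarrow> 'a^'n^'n" where
  "matpow A 0 = mat 1"
| "matpow A (Suc k) = matpow A k ** A"

lemma matpow_commute: "A ** matpow A k = matpow A k ** A"
  by (induction k) (simp_all add: matrix_mul_assoc)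

lemma matpow_add: "matpow A (m + n) = matpow A m ** matpow A n"
  by (induction n) (simp_all add: matrix_mul_assoc)

lemma matpow_mult: "matpow A (m * n) = matpow (matpow A m) n"
  by (induction n) (simp_all add: matpow_add add.commute matpow_commute)

lemma matrix_vector_mul_matpow: "(*v) (matpow A k) = ((*v) A) ^^ k"
  by (induction k)
    (simp_all add: fun_eq_iff matrix_vector_mul_assoc[symmetric] matpow_commute[symmetric])

lemma continuous_on_matpow: "continuous_on S (\<lambda>A::real^'n^'n. matpow A k)"
proof (induction k)
  case (Suc k)
  then show ?case
    unfolding matpow.simps matrix_matrix_mult_def by (intro continuous_intros)
qed simp

lemma onorm_matrix_nonneg: "0 \<le> onorm ((*v) (A::real^'n^'m))"
  by (rule onorm_pos_le[OF matrix_vector_mul_bounded_linear])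

lemma onorm_matrix_mul_le: "onorm ((*v) (A ** B)) \<le> onorm ((*v) A) * onorm ((*v) (B::real^'n^'m))"
  using onorm_compose[OF matrix_vector_mul_bounded_linear matrix_vector_mul_bounded_linear, of A B]
  by (simp add: o_def matrix_vector_mul_assoc)

lemma onorm_mat_1: "onorm ((*v) (mat 1 :: real^'n^'n)) = 1"
proof -
  have "(*v) (mat 1 :: real^'n^'n) = (\<lambda>x. x)"
    by (rule ext) (rule matrix_vector_mul_lid)
  then show ?thesis
    by (simp add: onorm_id)
qed

lemma onorm_matpow_le: "onorm ((*v) (matpow A k)) \<le> onorm ((*v) (A::real^'n^'n)) ^ k"
proof (induction k)
  case 0
  then show ?case by (simp add: onorm_id)
next
  case (Suc k)
  have "onorm ((*v) (matpow A (Suc k))) \<le> onorm ((*v) (matpow A k)) * onorm ((*v) A)"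
    by (simp add: onorm_matrix_mul_le)
  also have "\<dots> \<le> onorm ((*v) A) ^ k * onorm ((*v) A)"
    by (rule mult_right_mono[OF Suc onorm_matrix_nonneg])
  finally show ?case
    by (simp add: mult.commute)
qed

lemma continuous_on_onorm_matrix: "continuous_on S (\<lambda>A::real^'n^'m. onorm ((*v) A))"
proof -
  have "onorm ((*v) A) = norm (Blinfun ((*v) A))" for A :: "real^'n^'m"
    by (simp add: norm_blinfun.rep_eq bounded_linear_Blinfun_apply matrix_vector_mul_bounded_linear)
  moreover have "continuous_on S (\<lambda>A::real^'n^'m. Blinfun ((*v) A))"
    unfolding Blinfun_eq_matrix[OF matrix_vector_mul_bounded_linear] matrix_vector_mult_def
    by (intro continuous_intros)
  ultimately show ?thesis
    by (simp add: continuous_on_norm)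
qed

lemma onorm_matpow_le_div_mod:
  fixes B :: "real^'n^'n"
  shows "onorm ((*v) (matpow B n)) \<le>
    onorm ((*v) (matpow B p)) ^ (n div p) * onorm ((*v) B) ^ (n mod p)"
proof -
  have "matpow B n = matpow (matpow B p) (n div p) ** matpow B (n mod p)"
    by (simp flip: matpow_mult matpow_add)
  then have "onorm ((*v) (matpow B n)) \<le>
      onorm ((*v) (matpow (matpow B p) (n div p))) * onorm ((*v) (matpow B (n mod p)))"
    by (simp add: onorm_matrix_mul_le)
  also have "\<dots> \<le> onorm ((*v) (matpow B p)) ^ (n div p) * onorm ((*v) B) ^ (n mod p)"
    by (intro mult_mono onorm_matpow_le zero_le_power onorm_matrix_nonneg)
  finally show ?thesis .
qed

lemma onorm_matpow_uniformly_small_near: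
  fixes A :: "real^'n^'n"
  assumes Ap: "onorm ((*v) (matpow A p)) < 1" and "0 < \<epsilon>"
  shows "\<exists>U. open U \<and> A \<in> U \<and> (\<forall>\<^sub>F n in sequentially. \<forall>B\<in>U. onorm ((*v) (matpow B n)) < \<epsilon>)"
proof -
  define q where "q = (1 + onorm ((*v) (matpow A p))) / 2"
  define E where "E = onorm ((*v) A) + 1"
  have q: "onorm ((*v) (matpow A p)) < q" "q < 1"
    using Ap by (auto simp: q_def)
  have E: "1 \<le> E"
    using onorm_matrix_nonneg[of A] by (simp add: E_def)
  define U :: "(real^'n^'n) set"
    where "U = {B. onorm ((*v) (matpow B p)) < q} \<inter> {B. onorm ((*v) B) < E}"
  have "continuous_on UNIV (\<lambda>B::real^'n^'n. onorm ((*v) (matpow B p)))"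
    by (rule continuous_on_compose2[OF continuous_on_onorm_matrix continuous_on_matpow]) auto
  then have "open U"
    unfolding U_def
    by (intro open_Int open_Collect_less continuous_on_const continuous_on_onorm_matrix)
  moreover have "A \<in> U"
    using q by (simp add: U_def E_def)
  moreover have "p \<noteq> 0"
  proof
    assume "p = 0"
    then have "onorm ((*v) (matpow A p)) = 1"
      using onorm_mat_1 by simp
    with Ap show False
      by simp
  qed
  obtain k where k: "q ^ k < \<epsilon> / E ^ p"
    using real_arch_pow_inv[of "\<epsilon> / E ^ p" q] q(2) \<open>0 < \<epsilon>\<close> E by auto
  have "onorm ((*v) (matpow B n)) < \<epsilon>" if B: "B \<in> U" and n: "p * k \<le> n" for B n
  proof -
    have "k \<le> n div p"
      using n \<open>p \<noteq> 0\<close> by (simp add: less_eq_div_iff_mult_less_eq mult.commute)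
    have "n mod p \<le> p"
      using \<open>p \<noteq> 0\<close> by (simp add: less_imp_le)
    have "onorm ((*v) (matpow B n)) \<le>
        onorm ((*v) (matpow B p)) ^ (n div p) * onorm ((*v) B) ^ (n mod p)"
      by (rule onorm_matpow_le_div_mod)
    also have "\<dots> \<le> q ^ k * E ^ p"
    proof (intro mult_mono)
      have "onorm ((*v) (matpow B p)) ^ (n div p) \<le> q ^ (n div p)"
        using B onorm_matrix_nonneg by (intro power_mono) (auto simp: U_def)
      also have "\<dots> \<le> q ^ k"
        using q onorm_matrix_nonneg[of "matpow A p"] \<open>k \<le> n div p\<close> by (intro power_decreasing) auto
      finally show "onorm ((*v) (matpow B p)) ^ (n div p) \<le> q ^ k" .
      have "onorm ((*v) B) ^ (n mod p) \<le> E ^ (n mod p)"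
        using B onorm_matrix_nonneg by (intro power_mono) (auto simp: U_def)
      also have "\<dots> \<le> E ^ p"
        using E \<open>n mod p \<le> p\<close> by (rule power_increasing[rotated])
      finally show "onorm ((*v) B) ^ (n mod p) \<le> E ^ p" .
    qed (use E q onorm_matrix_nonneg[of "matpow A p"] onorm_matrix_nonneg[of B] in auto)
    also have "\<dots> < \<epsilon>"
      using k E by (simp add: pos_less_divide_eq)
    finally show ?thesis .
  qed
  then have "\<forall>\<^sub>F n in sequentially. \<forall>B\<in>U. onorm ((*v) (matpow B n)) < \<epsilon>"
    unfolding eventually_sequentially by blast
  ultimately show ?thesis
    by blast
qed

lemma pow_smult_mat:
  assumes "A \<in> carrier_mat n n"
  shows "(a \<cdot>\<^sub>m A) ^\<^sub>m k = (a ^ k :: 'a::comm_semiring_1) \<cdot>\<^sub>m A ^\<^sub>m k"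
proof (induction k)
  case 0
  then show ?case
    using assms by (intro eq_matI) auto
next
  case (Suc k)
  have "(a \<cdot>\<^sub>m A) ^\<^sub>m Suc k = (a ^ k \<cdot>\<^sub>m A ^\<^sub>m k) * (a \<cdot>\<^sub>m A)"
    by (simp add: Suc)
  also have "\<dots> = a ^ k \<cdot>\<^sub>m (A ^\<^sub>m k * (a \<cdot>\<^sub>m A))"
    by (rule mult_smult_assoc_mat) (use assms in auto)
  also have "A ^\<^sub>m k * (a \<cdot>\<^sub>m A) = a \<cdot>\<^sub>m (A ^\<^sub>m k * A)"
    by (rule mult_smult_distrib) (use assms in auto)
  also have "a ^ k \<cdot>\<^sub>m (a \<cdot>\<^sub>m (A ^\<^sub>m k * A)) = a ^ Suc k \<cdot>\<^sub>m A ^\<^sub>m Suc k"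
    by (intro eq_matI) (auto simp: mult_ac)
  finally show ?case .
qed

lemma eigenvalue_smult_mat:
  fixes A :: "'a::field mat"
  assumes A: "A \<in> carrier_mat n n" and "a \<noteq> 0" and "eigenvalue (a \<cdot>\<^sub>m A) e"
  shows "eigenvalue A (e / a)"
proof -
  obtain v where v: "v \<in> carrier_vec n" "v \<noteq> 0\<^sub>v n" and ev: "(a \<cdot>\<^sub>m A) *\<^sub>v v = e \<cdot>\<^sub>v v"
    using assms by (auto simp: eigenvalue_def eigenvector_def)
  have "A *\<^sub>v v = (e / a) \<cdot>\<^sub>v v"
  proof (rule eq_vecI)
    fix i
    assume "i < dim_vec ((e / a) \<cdot>\<^sub>v v)"
    then have i: "i < n"
      using v by simp
    have "a * Matrix.vec_index (A *\<^sub>v v) i = e * Matrix.vec_index v i"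
      using arg_cong[OF ev, of "\<lambda>w. Matrix.vec_index w i"] i A v by simp
    then show "Matrix.vec_index (A *\<^sub>v v) i = Matrix.vec_index ((e / a) \<cdot>\<^sub>v v) i"
      using i A v \<open>a \<noteq> 0\<close> by (simp add: field_simps)
  qed (use A v in simp)
  then show ?thesis
    using A v by (auto simp: eigenvalue_def eigenvector_def)
qed

lemma norm_bound_pow_mat_if_spectral_radius_less:
  fixes A :: "complex mat"
  assumes A: "A \<in> carrier_mat n n" and sr: "spectral_radius A < r"
  shows "\<exists>c. \<forall>k. norm_bound (A ^\<^sub>m k) (c * r ^ k)"
proof (cases "n = 0")
  case True
  then show ?thesis
    using A by (auto simp: norm_bound_def)
next
  case False
  then have "0 \<le> spectral_radius A"
    using spectral_radius_mem_max(1)[OF A] by auto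
  with sr have "0 < r"
    by linarith
  txt \<open>Rescaling by \<open>1 / r\<close> pushes the spectral radius below 1, where the powers are bounded.\<close>
  define B where "B = (1 / of_real r) \<cdot>\<^sub>m A"
  have B: "B \<in> carrier_mat n n"
    using A by (simp add: B_def)
  obtain e where e: "spectral_radius B = cmod e" "eigenvalue B e"
    using spectral_radius_mem_max(1)[OF B] False by (auto simp: spectrum_def)
  have "eigenvalue A (e * of_real r)"
    using eigenvalue_smult_mat[OF A _ e(2)[unfolded B_def]] \<open>0 < r\<close> by simp
  then have "cmod (e * of_real r) \<le> spectral_radius A"
    using spectral_radius_mem_max(2)[OF A] False by (auto simp: spectrum_def)
  then have "cmod e * r \<le> spectral_radius A"
    using \<open>0 < r\<close> by (simp add: norm_mult)
  then have "spectral_radius B < 1"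
    using e(1) sr mult_less_cancel_left_pos[OF \<open>0 < r\<close>, of "cmod e" 1] by (simp add: mult.commute)
  then obtain c where c: "\<And>k. norm_bound (B ^\<^sub>m k) c"
    using spectral_radius_jnf_norm_bound_less_1_upper_triangular[OF B] by blast
  have "A = of_real r \<cdot>\<^sub>m B"
    using A \<open>0 < r\<close> by (intro eq_matI) (auto simp: B_def)
  then have "A ^\<^sub>m k = of_real r ^ k \<cdot>\<^sub>m B ^\<^sub>m k" for k
    using B by (simp add: pow_smult_mat)
  then have "norm_bound (A ^\<^sub>m k) (c * r ^ k)" for k
    using c[of k] \<open>0 < r\<close>
    by (auto simp: norm_bound_def norm_mult norm_power mult.commute intro: mult_left_mono)
  then show ?thesis
    by blast
qed

text \<open>Jordan_Normal_Form matrices are indexed by \<open>{0..<n}\<close>; \<open>cart_index\<close> fixes an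
  enumeration of a finite index type to move between the two matrix representations.\<close>

definition cart_index :: "nat \<Rightarrow> 'n::finite" where
  "cart_index = (SOME f. bij_betw f {0..<CARD('n)} UNIV)"

lemma bij_betw_cart_index: "bij_betw (cart_index :: nat \<Rightarrow> 'n::finite) {0..<CARD('n)} UNIV"
proof -
  have "\<exists>f. bij_betw f {0..<CARD('n)} (UNIV :: 'n set)"
    by (rule ex_bij_betw_nat_finite) simp
  then show ?thesis
    unfolding cart_index_def by (rule someI_ex)
qed

lemma sum_UNIV_cart_index: "sum g (UNIV :: 'n::finite set) = (\<Sum>i = 0..<CARD('n). g (cart_index i))"
  by (rule sum.reindex_bij_betw[OF bij_betw_cart_index, symmetric])

lemma cart_index_eq_iff:
  "i < CARD('n) \<Longrightarrow> j < CARD('n) \<Longrightarrow> (cart_index i :: 'n::finite) = cart_index j \<longleftrightarrow> i = j"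
  using bij_betw_imp_inj_on[OF bij_betw_cart_index[where 'n='n]] by (auto simp: inj_on_def)

lemma ex_cart_index: "\<exists>i<CARD('n). cart_index i = (k :: 'n::finite)"
proof -
  have "k \<in> cart_index ` {0..<CARD('n)}"
    using bij_betw_imp_surj_on[OF bij_betw_cart_index[where 'n='n]] by simp
  then show ?thesis
    by auto
qed

definition mat_of_cart :: "'a^'n^'n \<Rightarrow> 'a mat" where
  "mat_of_cart A = Matrix.mat CARD('n::finite) CARD('n) (\<lambda>(i, j). A $ cart_index i $ cart_index j)"

definition vec_of_cart :: "'a^'n \<Rightarrow> 'a Matrix.vec" where
  "vec_of_cart x = Matrix.vec CARD('n::finite) (\<lambda>i. x $ cart_index i)"

lemma mat_of_cart_carrier [simp]:
  "mat_of_cart (A :: 'a^'n^'n) \<in> carrier_mat CARD('n::finite) CARD('n)"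
  by (simp add: mat_of_cart_def)

lemma dim_mat_of_cart [simp]:
  "dim_row (mat_of_cart (A :: 'a^'n^'n)) = CARD('n::finite)" "dim_col (mat_of_cart A) = CARD('n)"
  by (simp_all add: mat_of_cart_def)

lemma vec_of_cart_carrier [simp]: "vec_of_cart (x :: 'a^'n) \<in> carrier_vec CARD('n::finite)"
  by (simp add: vec_of_cart_def)

lemma vec_of_cart_eq_iff: "vec_of_cart x = vec_of_cart y \<longleftrightarrow> x = (y :: 'a^'n::finite)"
proof
  assume eq: "vec_of_cart x = vec_of_cart y"
  show "x = y"
  proof (rule Finite_Cartesian_Product.vec_eq_iff[THEN iffD2], rule allI)
    fix k :: 'n
    obtain i where i: "i < CARD('n)" "cart_index i = k"
      using ex_cart_index by blast
    have "Matrix.vec_index (vec_of_cart x) i = Matrix.vec_index (vec_of_cart y) i"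
      by (simp only: eq)
    then show "x $ k = y $ k"
      using i by (simp add: vec_of_cart_def)
  qed
qed (rule arg_cong)

lemma vec_of_cart_0 [simp]: "vec_of_cart (0 :: 'a::zero^'n) = 0\<^sub>v CARD('n::finite)"
  by (rule eq_vecI) (auto simp: vec_of_cart_def)

lemma vec_of_cart_smult: "vec_of_cart (c *s x) = c \<cdot>\<^sub>v vec_of_cart x"
  by (rule eq_vecI) (auto simp: vec_of_cart_def)

lemma ex_vec_of_cart:
  assumes "v \<in> carrier_vec CARD('n::finite)"
  shows "\<exists>x::'a^'n. vec_of_cart x = v"
proof
  let ?x = "(\<chi> k. Matrix.vec_index v (inv_into {0..<CARD('n)} cart_index k)) :: 'a^'n"
  show "vec_of_cart ?x = v"
  proof (rule eq_vecI)
    fix i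
    assume "i < dim_vec v"
    then have "inv_into {0..<CARD('n)} cart_index (cart_index i :: 'n) = i"
      using assms bij_betw_imp_inj_on[OF bij_betw_cart_index[where 'n='n]]
      by (simp add: inv_into_f_f)
    then show "Matrix.vec_index (vec_of_cart ?x) i = Matrix.vec_index v i"
      using \<open>i < dim_vec v\<close> assms by (simp add: vec_of_cart_def)
  qed (use assms in \<open>simp add: vec_of_cart_def\<close>)
qed

lemma mat_of_cart_mult:
  "mat_of_cart (A ** B) = mat_of_cart A * mat_of_cart (B :: 'a::comm_semiring_1^'n^'n)"
  by (rule eq_matI)
    (auto simp: mat_of_cart_def scalar_prod_def matrix_matrix_mult_def sum_UNIV_cart_index)

lemma mat_of_cart_mat_1: "mat_of_cart (mat 1 :: 'a::semiring_1^'n^'n) = 1\<^sub>m CARD('n)"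
  by (rule eq_matI) (auto simp: mat_of_cart_def Finite_Cartesian_Product.mat_def cart_index_eq_iff)

lemma mat_of_cart_matpow:
  "mat_of_cart (matpow A k) = mat_of_cart (A :: 'a::comm_semiring_1^'n^'n) ^\<^sub>m k"
  by (induction k) (simp_all add: mat_of_cart_mult mat_of_cart_mat_1)

lemma mat_of_cart_mult_vec:
  "mat_of_cart A *\<^sub>v vec_of_cart x = vec_of_cart (A *v (x :: 'a::comm_semiring_1^'n))"
  by (rule eq_vecI)
    (auto simp: mat_of_cart_def vec_of_cart_def scalar_prod_def matrix_vector_mult_def sum_UNIV_cart_index)

lemma eigenvalue_mat_of_cart_iff:
  "eigenvalue (mat_of_cart A) e \<longleftrightarrow> (\<exists>x. x \<noteq> 0 \<and> A *v x = e *s (x :: 'a::field^'n))"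
proof
  assume "eigenvalue (mat_of_cart A) e"
  then obtain v where v: "v \<in> carrier_vec CARD('n)" "v \<noteq> 0\<^sub>v CARD('n)" "mat_of_cart A *\<^sub>v v = e \<cdot>\<^sub>v v"
    by (auto simp: eigenvalue_def eigenvector_def)
  obtain x :: "'a^'n" where x: "vec_of_cart x = v"
    using ex_vec_of_cart[OF v(1)] by blast
  have "vec_of_cart (A *v x) = vec_of_cart (e *s x)"
    using v(3) by (simp add: x vec_of_cart_smult flip: mat_of_cart_mult_vec)
  moreover have "x \<noteq> 0"
    using v(2) x by auto
  ultimately show "\<exists>x. x \<noteq> 0 \<and> A *v x = e *s x"
    by (auto simp only: vec_of_cart_eq_iff)
next
  assume "\<exists>x. x \<noteq> 0 \<and> A *v x = e *s x"
  then obtain x where x: "x \<noteq> 0" "A *v x = e *s x"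
    by blast
  have "vec_of_cart x \<noteq> 0\<^sub>v CARD('n)"
    using x(1) by (simp flip: vec_of_cart_0 add: vec_of_cart_eq_iff)
  moreover have "mat_of_cart A *\<^sub>v vec_of_cart x = e \<cdot>\<^sub>v vec_of_cart x"
    by (simp add: mat_of_cart_mult_vec x(2) vec_of_cart_smult)
  ultimately show "eigenvalue (mat_of_cart A) e"
    unfolding eigenvalue_def eigenvector_def by (intro exI[of _ "vec_of_cart x"]) simp
qed

lemma matrix_vector_mult_mat: "mat c *v x = c *s (x :: 'a::semiring_1^'n)"
proof -
  have "(\<Sum>j\<in>UNIV. mat c $ i $ j * x $ j) = c * x $ i" for i
  proof -
    have "(\<Sum>j\<in>UNIV. mat c $ i $ j * x $ j) = (\<Sum>j\<in>UNIV. if j = i then c * x $ i else 0)"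
      by (rule sum.cong) (auto simp: Finite_Cartesian_Product.mat_def)
    then show ?thesis
      by simp
  qed
  then show ?thesis
    by (simp add: Finite_Cartesian_Product.vec_eq_iff matrix_vector_mult_def)
qed

lemma det_eq_0_iff_eigenvector:
  "det (mat e - A) = 0 \<longleftrightarrow> (\<exists>x. x \<noteq> 0 \<and> A *v x = e *s (x :: 'a::field^'n))"
proof -
  have "det (mat e - A) \<noteq> 0 \<longleftrightarrow> (\<forall>x. (mat e - A) *v x = 0 \<longrightarrow> x = 0)"
    by (simp add: invertible_det_nz[symmetric] invertible_left_inverse matrix_left_invertible_ker)
  then show ?thesis
    by (auto simp: matrix_vector_mult_diff_rdistrib matrix_vector_mult_mat)
qed

lemma cmat_mult: "cmat (A ** B) = cmat A ** cmat B"
  by (simp add: Finite_Cartesian_Product.vec_eq_iff cmat_def matrix_matrix_mult_def)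

lemma cmat_mat_1: "cmat (mat 1) = mat 1"
  by (simp add: Finite_Cartesian_Product.vec_eq_iff cmat_def Finite_Cartesian_Product.mat_def)

lemma cmat_matpow: "cmat (matpow A k) = matpow (cmat A) k"
  by (induction k) (simp_all add: cmat_mult cmat_mat_1)

lemma spectrum_mat_of_cart:
  fixes A :: "'a::field^'n^'n"
  shows "spectrum (mat_of_cart A) = {z. det (mat z - A) = 0}"
  by (auto simp: spectrum_def eigenvalue_mat_of_cart_iff det_eq_0_iff_eigenvector)

lemma spectral_radius_mat_eq: "spectral_radius_mat A = spectral_radius (mat_of_cart (cmat A))"
  unfolding spectral_radius_mat_def spectral_radius_def spectrum_mat_of_cart
  by (rule arg_cong[where f = Max]) auto

lemma abs_matpow_le_if_spectral_radius_less:
  fixes A :: "real^'n^'n"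
  assumes "spectral_radius_mat A < r"
  shows "\<exists>c. \<forall>k i j. \<bar>matpow A k $ i $ j\<bar> \<le> c * r ^ k"
proof -
  obtain c where c: "\<And>k. norm_bound (mat_of_cart (cmat A) ^\<^sub>m k) (c * r ^ k)"
    using norm_bound_pow_mat_if_spectral_radius_less[OF mat_of_cart_carrier] assms
    unfolding spectral_radius_mat_eq by blast
  have "\<bar>matpow A k $ i $ j\<bar> \<le> c * r ^ k" for k i j
  proof -
    obtain i' where i': "i' < CARD('n)" "cart_index i' = i"
      using ex_cart_index by blast
    obtain j' where j': "j' < CARD('n)" "cart_index j' = j"
      using ex_cart_index by blast
    from i' j' have "\<bar>matpow A k $ i $ j\<bar> = cmod ((mat_of_cart (cmat A) ^\<^sub>m k) $$ (i', j'))"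
      by (simp flip: mat_of_cart_matpow cmat_matpow) (simp add: mat_of_cart_def cmat_def)
    also have "\<dots> \<le> c * r ^ k"
      using c[of k] i' j' by (simp add: norm_bound_def)
    finally show ?thesis .
  qed
  then show ?thesis
    by blast
qed

lemma onorm_matpow_tendsto_0:
  fixes A :: "real^'n^'n"
  assumes "spectral_radius_mat A < 1"
  shows "(\<lambda>k. onorm ((*v) (matpow A k))) \<longlonglongrightarrow> 0"
proof -
  define r where "r = max (1 / 2) ((1 + spectral_radius_mat A) / 2)"
  have r: "0 < r" "r < 1" "spectral_radius_mat A < r"
    using assms unfolding r_def by (simp_all add: less_max_iff_disj)
  obtain c where c: "\<And>k i j. \<bar>matpow A k $ i $ j\<bar> \<le> c * r ^ k"
    using abs_matpow_le_if_spectral_radius_less[OF r(3)] by blast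
  define K where "K = real CARD('n) * real CARD('n) * c"
  have bound: "\<forall>k. norm (onorm ((*v) (matpow A k))) \<le> K * r ^ k"
  proof
    fix k
    have "norm (onorm ((*v) (matpow A k))) = onorm ((*v) (matpow A k))"
      using onorm_matrix_nonneg[of "matpow A k"] by simp
    also have "\<dots> \<le> real CARD('n) * real CARD('n) * (c * r ^ k)"
      by (rule onorm_le_matrix_component) (rule c)
    finally show "norm (onorm ((*v) (matpow A k))) \<le> K * r ^ k"
      by (simp add: K_def mult.assoc)
  qed
  have "(\<lambda>k. K * r ^ k) \<longlonglongrightarrow> 0"
    using r by (intro tendsto_mult_right_zero LIMSEQ_power_zero) auto
  then show ?thesis
    by (rule Lim_null_comparison[OF always_eventually[OF bound]])
qed

lemma inj_id_minus_if_spectral_radius_less_1: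
  fixes A :: "real^'n^'n"
  assumes "spectral_radius_mat A < 1"
  shows "inj (\<lambda>v. v - A *v v)"
proof (rule injI)
  fix v w :: "real^'n"
  assume "v - A *v v = w - A *v w"
  then have Au: "A *v (v - w) = v - w"
    by (simp add: matrix_vector_mult_diff_distrib algebra_simps)
  show "v = w"
  proof (rule ccontr)
    assume "v \<noteq> w"
    define u :: "complex^'n" where "u = (\<chi> i. complex_of_real ((v - w) $ i))"
    have "u \<noteq> 0"
      using \<open>v \<noteq> w\<close> by (auto simp: u_def Finite_Cartesian_Product.vec_eq_iff)
    have "(cmat A *v u) $ i = complex_of_real ((A *v (v - w)) $ i)" for i
      by (simp add: u_def cmat_def matrix_vector_mult_def)
    then have "cmat A *v u = 1 *s u"
      using Au by (simp add: Finite_Cartesian_Product.vec_eq_iff u_def)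
    with \<open>u \<noteq> 0\<close> have "eigenvalue (mat_of_cart (cmat A)) 1"
      by (auto simp: eigenvalue_mat_of_cart_iff)
    then have "cmod 1 \<le> spectral_radius (mat_of_cart (cmat A))"
      by (intro spectral_radius_mem_max(2)[OF mat_of_cart_carrier])
        (auto simp: spectrum_def intro!: image_eqI[where x = 1])
    then show False
      using assms by (simp add: spectral_radius_mat_eq)
  qed
qed

lemma onorm_matpow_uniformly_small_near_if_spectral_radius_less_1:
  fixes A :: "real^'n^'n"
  assumes "spectral_radius_mat A < 1" and "0 < \<epsilon>"
  shows "\<exists>U. open U \<and> A \<in> U \<and> (\<forall>\<^sub>F n in sequentially. \<forall>B\<in>U. onorm ((*v) (matpow B n)) < \<epsilon>)"
proof -
  have "\<forall>\<^sub>F p in sequentially. onorm ((*v) (matpow A p)) < 1"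
    using order_tendstoD(2)[OF onorm_matpow_tendsto_0[OF assms(1)]] by simp
  then obtain p where "onorm ((*v) (matpow A p)) < 1"
    unfolding eventually_sequentially by blast
  then show ?thesis
    using assms(2) by (rule onorm_matpow_uniformly_small_near)
qed

lemma compact_imp_eventually_on_open_superset:
  assumes "compact K"
    and "\<And>x. x \<in> K \<Longrightarrow> \<exists>U. open U \<and> x \<in> U \<and> (\<forall>\<^sub>F n in F. \<forall>y\<in>U. P n y)"
  shows "\<exists>W. open W \<and> K \<subseteq> W \<and> (\<forall>\<^sub>F n in F. \<forall>y\<in>W. P n y)"
proof -
  have "\<forall>x\<in>K. \<exists>U. open U \<and> x \<in> U \<and> (\<forall>\<^sub>F n in F. \<forall>y\<in>U. P n y)"
    using assms(2) by blast
  then obtain U where U: "\<forall>x\<in>K. open (U x) \<and> x \<in> U x \<and> (\<forall>\<^sub>F n in F. \<forall>y\<in>U x. P n y)"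
    by (rule bchoice[THEN exE])
  have "\<And>x. x \<in> K \<Longrightarrow> open (U x)" and "K \<subseteq> (\<Union>x\<in>K. U x)"
    using U by auto
  then obtain C where C: "C \<subseteq> K" "finite C" "K \<subseteq> (\<Union>x\<in>C. U x)"
    by (rule compactE_image[OF assms(1)])
  have "\<forall>\<^sub>F n in F. \<forall>x\<in>C. \<forall>y\<in>U x. P n y"
    by (rule eventually_ball_finite[OF C(2)]) (use C(1) U in blast)
  then have "\<forall>\<^sub>F n in F. \<forall>y\<in>(\<Union>x\<in>C. U x). P n y"
    by (rule eventually_mono) blast
  moreover have "open (\<Union>x\<in>C. U x)"
    using C(1) U by blast
  ultimately show ?thesis
    using C(3) by blast
qed

lemma eventually_along_path_with_limits:
  fixes g :: "real \<Rightarrow> 'a::topological_space"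
  assumes g: "continuous_on UNIV g" "(g \<longlongrightarrow> a) at_top" "(g \<longlongrightarrow> b) at_bot"
    and near: "\<And>x. x \<in> insert a (insert b (range g)) \<Longrightarrow>
      \<exists>U. open U \<and> x \<in> U \<and> (\<forall>\<^sub>F n in F. \<forall>y\<in>U. P n y)"
  shows "\<forall>\<^sub>F n in F. \<forall>s. P n (g s)"
proof -
  have "\<exists>W. open W \<and> {a, b} \<subseteq> W \<and> (\<forall>\<^sub>F n in F. \<forall>y\<in>W. P n y)"
    by (rule compact_imp_eventually_on_open_superset) (use near in auto)
  then obtain W0 where W0: "open W0" "{a, b} \<subseteq> W0" "\<forall>\<^sub>F n in F. \<forall>y\<in>W0. P n y"
    by blast
  obtain T1 where T1: "\<And>s. s \<ge> T1 \<Longrightarrow> g s \<in> W0"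
    using topological_tendstoD[OF g(2) W0(1)] W0(2) unfolding eventually_at_top_linorder by auto
  obtain T0 where T0: "\<And>s. s \<le> T0 \<Longrightarrow> g s \<in> W0"
    using topological_tendstoD[OF g(3) W0(1)] W0(2) unfolding eventually_at_bot_linorder by auto
  have "compact (g ` {T0..T1})"
    by (intro compact_continuous_image continuous_on_subset[OF g(1)] compact_Icc) auto
  then have "\<exists>W. open W \<and> g ` {T0..T1} \<subseteq> W \<and> (\<forall>\<^sub>F n in F. \<forall>y\<in>W. P n y)"
    by (rule compact_imp_eventually_on_open_superset) (use near in auto)
  then obtain W1 where W1: "open W1" "g ` {T0..T1} \<subseteq> W1" "\<forall>\<^sub>F n in F. \<forall>y\<in>W1. P n y"
    by blast
  have cover: "g s \<in> W0 \<union> W1" for s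
  proof (cases "s \<le> T0 \<or> T1 \<le> s")
    case False
    then have "g s \<in> g ` {T0..T1}"
      by auto
    then show ?thesis
      using W1(2) by blast
  qed (use T0 T1 in blast)
  show ?thesis
    using eventually_conj[OF W0(3) W1(3)] by (rule eventually_mono) (use cover in blast)
qed

lemma C1_map_has_derivative:
  assumes "C1_map f"
  shows "(f has_derivative frechet_derivative f (at p)) (at p)"
  using assms frechet_derivative_works unfolding C1_map_def by blast

lemma C1_map_bounded_linear:
  assumes "C1_map f"
  shows "bounded_linear (frechet_derivative f (at p))"
  using has_derivative_bounded_linear[OF C1_map_has_derivative[OF assms]] .

lemma C1_map_has_derivative_partial:
  assumes "C1_map f"
  shows "((\<lambda>x. f (x, l)) has_derivative (\<lambda>v. frechet_derivative f (at (x, l)) (v, 0))) (at x)"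
proof -
  have "((\<lambda>x. (x, l)) has_derivative (\<lambda>v. (v, 0))) (at x)"
    by (intro has_derivative_Pair has_derivative_ident has_derivative_const)
  from has_derivative_compose[OF this C1_map_has_derivative[OF assms]] show ?thesis
    by simp
qed

lemma C1_map_continuous: "C1_map f \<Longrightarrow> continuous_on UNIV f"
  by (intro continuous_at_imp_continuous_on ballI
      has_derivative_continuous[OF C1_map_has_derivative])

lemma C1_map_derivative_near:
  assumes "C1_map f" and "0 < e"
  shows "\<exists>\<eta>>0. \<forall>p v. dist p p0 < \<eta> \<longrightarrow>
           norm (frechet_derivative f (at p) v - frechet_derivative f (at p0) v) \<le> e * norm v"
proof -
  define D where "D p = Blinfun (frechet_derivative f (at p))" for p
  have D_apply: "blinfun_apply (D p) = frechet_derivative f (at p)" for p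
    unfolding D_def by (rule bounded_linear_Blinfun_apply[OF C1_map_bounded_linear[OF assms(1)]])
  have "isCont D p0"
    using assms(1) unfolding C1_map_def D_def[abs_def] by (simp add: continuous_on_eq_continuous_at)
  from this[unfolded continuous_at_eps_delta, rule_format, OF assms(2)]
  obtain \<eta> where "\<eta> > 0" and \<eta>: "\<forall>p. dist p p0 < \<eta> \<longrightarrow> dist (D p) (D p0) < e"
    by blast
  have "norm (frechet_derivative f (at p) v - frechet_derivative f (at p0) v) \<le> e * norm v"
    if "dist p p0 < \<eta>" for p v
  proof -
    have "norm (frechet_derivative f (at p) v - frechet_derivative f (at p0) v) =
        norm (blinfun_apply (D p - D p0) v)"
      by (simp add: D_apply blinfun.diff_left)
    also have "\<dots> \<le> norm (D p - D p0) * norm v"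
      by (rule norm_blinfun)
    also have "\<dots> \<le> e * norm v"
      using \<eta> that by (intro mult_right_mono) (simp_all add: dist_norm less_imp_le)
    finally show ?thesis .
  qed
  with \<open>\<eta> > 0\<close> show ?thesis
    by blast
qed

lemma C1_map_partial_linearization:
  fixes f :: "'a::real_normed_vector \<times> 'b::real_normed_vector \<Rightarrow> 'c::real_normed_vector"
  assumes "C1_map f" and "0 < e"
  shows "\<exists>\<eta>>0. \<forall>x y l. dist x x0 < \<eta> \<longrightarrow> dist y x0 < \<eta> \<longrightarrow> dist l l0 < \<eta> \<longrightarrow>
           norm (f (x, l) - f (y, l) - frechet_derivative f (at (x0, l0)) (x - y, 0))
             \<le> e * norm (x - y)"
proof -
  define D where "D p = frechet_derivative f (at p)" for p
  obtain \<eta> where "\<eta> > 0"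
    and near: "\<And>p v. dist p (x0, l0) < \<eta> \<Longrightarrow> norm (D p v - D (x0, l0) v) \<le> e * norm v"
    using C1_map_derivative_near[OF assms] unfolding D_def by blast
  have blD0: "bounded_linear (\<lambda>v. D (x0, l0) (v, 0))"
    unfolding D_def
    by (rule has_derivative_bounded_linear[OF C1_map_has_derivative_partial[OF assms(1)]])
  have "norm (f (x, l) - f (y, l) - D (x0, l0) (x - y, 0)) \<le> e * norm (x - y)"
    if x: "x \<in> ball x0 (\<eta>/2)" and y: "y \<in> ball x0 (\<eta>/2)" and l: "dist l l0 < \<eta>/2" for x y l
  proof -
    define \<phi> where "\<phi> z = f (z, l) - D (x0, l0) (z, 0)" for z
    have "(\<phi> has_derivative (\<lambda>v. D (z, l) (v, 0) - D (x0, l0) (v, 0))) (at z within ball x0 (\<eta>/2))"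
      for z
    proof -
      have "(\<phi> has_derivative (\<lambda>v. D (z, l) (v, 0) - D (x0, l0) (v, 0))) (at z)"
        unfolding \<phi>_def D_def
        by (rule has_derivative_diff[OF C1_map_has_derivative_partial[OF assms(1)]
              bounded_linear_imp_has_derivative[OF blD0[unfolded D_def]]])
      then show ?thesis
        by (rule has_derivative_at_withinI)
    qed
    moreover have "onorm (\<lambda>v. D (z, l) (v, 0) - D (x0, l0) (v, 0)) \<le> e"
      if "z \<in> ball x0 (\<eta>/2)" for z
    proof (rule onorm_bound)
      fix v
      have "dist (z, l) (x0, l0) \<le> dist z x0 + dist l l0"
        using norm_Pair_le[of "z - x0" "l - l0"] by (simp add: dist_norm)
      also have "\<dots> < \<eta>"
        using that l by (simp add: dist_commute)
      finally show "norm (D (z, l) (v, 0) - D (x0, l0) (v, 0)) \<le> e * norm v"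
        using near[of "(z, l)" "(v, 0)"] by (simp add: norm_Pair)
    qed (use assms(2) in simp)
    ultimately have "norm (\<phi> x - \<phi> y) \<le> e * norm (x - y)"
      by (rule differentiable_bound[OF convex_ball _ _ x y])
    moreover have "\<phi> x - \<phi> y = f (x, l) - f (y, l) - D (x0, l0) (x - y, 0)"
      using linear_diff[OF bounded_linear.linear[OF blD0], of x y] by (simp add: \<phi>_def)
    ultimately show ?thesis
      by simp
  qed
  then show ?thesis
    using \<open>\<eta> > 0\<close> unfolding D_def by (intro exI[of _ "\<eta>/2"]) (auto simp: dist_commute)
qed

lemma fixed_point_dist_le_defect:
  fixes f :: "'a::euclidean_space \<times> 'b::real_normed_vector \<Rightarrow> 'a"
  assumes "C1_map f" and inj: "inj (\<lambda>v. v - frechet_derivative f (at (x0, l0)) (v, 0))"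
  shows "\<exists>\<eta>>0. \<exists>c>0. \<forall>x l. dist x x0 < \<eta> \<longrightarrow> dist l l0 < \<eta> \<longrightarrow> f (x, l) = x \<longrightarrow>
           c * dist x x0 \<le> dist (f (x0, l)) x0"
proof -
  define D where "D v = frechet_derivative f (at (x0, l0)) (v, 0)" for v
  have "bounded_linear D"
    unfolding D_def
    by (rule has_derivative_bounded_linear[OF C1_map_has_derivative_partial[OF assms(1)]])
  then have "linear (\<lambda>v. v - D v)"
    by (intro linear_compose_sub bounded_linear.linear bounded_linear_ident)
  then obtain c where "c > 0" and c: "\<And>v. c * norm v \<le> norm (v - D v)"
    using linear_inj_bounded_below_pos inj unfolding D_def by blast
  obtain \<eta> where "\<eta> > 0" and \<eta>: "\<And>x y l. dist x x0 < \<eta> \<Longrightarrow> dist y x0 < \<eta> \<Longrightarrow> dist l l0 < \<eta> \<Longrightarrow>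
      norm (f (x, l) - f (y, l) - D (x - y)) \<le> c/2 * norm (x - y)"
    using C1_map_partial_linearization[OF assms(1), of "c/2" x0 l0] \<open>c > 0\<close> unfolding D_def by auto
  have "c/2 * dist x x0 \<le> dist (f (x0, l)) x0"
    if x: "dist x x0 < \<eta>" and l: "dist l l0 < \<eta>" and fp: "f (x, l) = x" for x l
  proof -
    have eq: "(x - x0) - D (x - x0) = (f (x0, l) - x0) + (f (x, l) - f (x0, l) - D (x - x0))"
      using fp by (simp add: algebra_simps)
    have "c * norm (x - x0) \<le> norm ((x - x0) - D (x - x0))"
      by (rule c)
    also have "\<dots> \<le> norm (f (x0, l) - x0) + norm (f (x, l) - f (x0, l) - D (x - x0))"
      unfolding eq by (rule norm_triangle_ineq)
    also have "\<dots> \<le> norm (f (x0, l) - x0) + c/2 * norm (x - x0)"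
      using \<eta>[OF x _ l, of x0] \<open>\<eta> > 0\<close> by simp
    finally show ?thesis
      by (simp add: dist_norm)
  qed
  then show ?thesis
    using \<open>\<eta> > 0\<close> \<open>c > 0\<close> by (intro exI[of _ \<eta>] conjI exI[of _ "c/2"] allI impI) auto
qed

lemma connected_graph_dist_le_right:
  fixes Y :: "real \<Rightarrow> 'a::metric_space"
  assumes conn: "connected (range (\<lambda>s. (s, Y s)))"
    and "e < \<eta>" and "0 < \<eta>"
    and gap: "\<And>s. s0 < s \<Longrightarrow> s < s0 + \<delta> \<Longrightarrow> dist (Y s) (Y s0) < \<eta> \<Longrightarrow> dist (Y s) (Y s0) \<le> e"
    and t: "s0 < t" "t < s0 + \<delta>"
  shows "dist (Y t) (Y s0) \<le> e"
proof (rule ccontr)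
  assume far: "\<not> dist (Y t) (Y s0) \<le> e"
  txt \<open>The gap makes \<open>U\<close> and \<open>V\<close> disjoint on the graph \<open>G\<close>.\<close>
  define G where "G = range (\<lambda>s. (s, Y s))"
  define U where "U = {p. fst p < s0} \<union> ({p. fst p < t} \<inter> {p. dist (snd p) (Y s0) < \<eta>})"
  define V where "V = {p. t < fst p} \<union>
    ({p. s0 < fst p} \<inter> {p. fst p < s0 + \<delta>} \<inter> {p. e < dist (snd p) (Y s0)})"
  have "open U" "open V"
    unfolding U_def V_def by (intro open_Un open_Int open_Collect_less continuous_intros)+
  moreover have "G \<subseteq> U \<union> V"
  proof
    fix p
    assume "p \<in> G"
    then obtain s where p: "p = (s, Y s)"
      by (auto simp: G_def)
    show "p \<in> U \<union> V"
    proof (cases "s < s0 \<or> (s < t \<and> dist (Y s) (Y s0) < \<eta>)")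
      case True
      then show ?thesis
        by (auto simp: p U_def)
    next
      case False
      then have "s0 \<le> s" "t \<le> s \<or> \<eta> \<le> dist (Y s) (Y s0)"
        by auto
      moreover have "s \<noteq> s0"
        using False t \<open>0 < \<eta>\<close> by auto
      ultimately show ?thesis
        using far t \<open>e < \<eta>\<close> by (cases "s = t") (auto simp: p V_def)
    qed
  qed
  moreover have "U \<inter> V \<inter> G = {}"
  proof -
    have False if pU: "p \<in> U" and pV: "p \<in> V" and pG: "p \<in> G" for p
    proof -
      obtain s where p: "p = (s, Y s)"
        using pG by (auto simp: G_def)
      have "\<not> s < s0"
        using pV t by (auto simp: p V_def)
      then have "s < t" "dist (Y s) (Y s0) < \<eta>"
        using pU by (auto simp: p U_def)
      moreover from this have "s0 < s" "s < s0 + \<delta>" "e < dist (Y s) (Y s0)"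
        using pV t by (auto simp: p V_def)
      ultimately show False
        using gap[of s] by linarith
    qed
    then show ?thesis
      by blast
  qed
  ultimately have "U \<inter> G = {} \<or> V \<inter> G = {}"
    using connectedD[OF conn[folded G_def]] by blast
  moreover have "(s0, Y s0) \<in> U \<inter> G" "(t, Y t) \<in> V \<inter> G"
    using t far \<open>0 < \<eta>\<close> by (auto simp: U_def V_def G_def)
  ultimately show False
    by blast
qed

lemma isCont_if_connected_graph:
  fixes Y :: "real \<Rightarrow> 'a::metric_space"
  assumes conn: "connected (range (\<lambda>s. (s, Y s)))" and "0 < \<eta>"
    and gap: "\<And>e. 0 < e \<Longrightarrow> \<forall>\<^sub>F s in at s0. dist (Y s) (Y s0) < \<eta> \<longrightarrow> dist (Y s) (Y s0) < e"
  shows "isCont Y s0"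
proof -
  have "connected ((\<lambda>p::real \<times> 'a. (- fst p, snd p)) ` range (\<lambda>s. (s, Y s)))"
    by (rule connected_continuous_image[OF _ conn]) (intro continuous_intros)
  moreover have "(\<lambda>p. (- fst p, snd p)) ` range (\<lambda>s. (s, Y s)) = range (\<lambda>s. (s, Y (- s)))"
    by (auto simp: image_iff intro!: exI[where x = "- _"])
  ultimately have conn': "connected (range (\<lambda>s. (s, Y (- s))))"
    by simp
  have "\<forall>\<^sub>F t in at s0. dist (Y t) (Y s0) < \<epsilon>" if "0 < \<epsilon>" for \<epsilon>
  proof -
    define e where "e = min (\<epsilon> / 2) (\<eta> / 2)"
    have e: "0 < e" "e < \<eta>" "e < \<epsilon>"
      using that \<open>0 < \<eta>\<close> by (auto simp: e_def)
    obtain \<delta> where "0 < \<delta>" and \<delta>: "\<And>s. s \<noteq> s0 \<Longrightarrow> dist s s0 < \<delta> \<Longrightarrow>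
        dist (Y s) (Y s0) < \<eta> \<Longrightarrow> dist (Y s) (Y s0) < e"
      using gap[OF e(1)] unfolding eventually_at by blast
    have "dist (Y t) (Y s0) \<le> e" if "t \<noteq> s0" "dist t s0 < \<delta>" for t
    proof (cases "s0 < t")
      case True
      show ?thesis
      proof (rule connected_graph_dist_le_right[OF conn e(2) \<open>0 < \<eta>\<close>, of s0 \<delta>])
        fix s
        assume "s0 < s" "s < s0 + \<delta>" "dist (Y s) (Y s0) < \<eta>"
        then show "dist (Y s) (Y s0) \<le> e"
          using \<delta>[of s] by (simp add: dist_real_def)
      qed (use that True in \<open>auto simp: dist_real_def\<close>)
    next
      case False
      have "dist (Y (- (- t))) (Y (- (- s0))) \<le> e"
      proof (rule connected_graph_dist_le_right[OF conn' e(2) \<open>0 < \<eta>\<close>, of "- s0" \<delta>])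
        fix s
        assume "- s0 < s" "s < - s0 + \<delta>" "dist (Y (- s)) (Y (- (- s0))) < \<eta>"
        then show "dist (Y (- s)) (Y (- (- s0))) \<le> e"
          using \<delta>[of "- s"] by (simp add: dist_real_def)
      qed (use that False in \<open>auto simp: dist_real_def\<close>)
      then show ?thesis
        by simp
    qed
    then have "dist (Y t) (Y s0) < \<epsilon>" if "t \<noteq> s0" "dist t s0 < \<delta>" for t
      using that e(3) by fastforce
    then show ?thesis
      unfolding eventually_at using \<open>0 < \<delta>\<close> by blast
  qed
  then show ?thesis
    unfolding isCont_def by (rule tendstoI)
qed

lemma continuous_on_fixed_point_curve:
  fixes f :: "'a::euclidean_space \<times> 'b::real_normed_vector \<Rightarrow> 'a"
    and \<Lambda> :: "real \<Rightarrow> 'b" and X :: "real \<Rightarrow> 'a"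
  assumes f: "C1_map f" and \<Lambda>: "continuous_on UNIV \<Lambda>"
    and fixed: "\<And>s. f (X s, \<Lambda> s) = X s"
    and conn: "connected (range (\<lambda>s. (s, X s)))"
    and inj: "\<And>s. inj (\<lambda>v. v - frechet_derivative f (at (X s, \<Lambda> s)) (v, 0))"
  shows "continuous_on UNIV X"
proof (intro continuous_at_imp_continuous_on ballI)
  fix s0 :: real
  obtain \<eta> c where "0 < \<eta>" "0 < c" and defect: "\<And>x l. dist x (X s0) < \<eta> \<Longrightarrow> dist l (\<Lambda> s0) < \<eta> \<Longrightarrow>
      f (x, l) = x \<Longrightarrow> c * dist x (X s0) \<le> dist (f (X s0, l)) (X s0)"
    using fixed_point_dist_le_defect[OF f inj] by blast
  have \<Lambda>_lim: "(\<Lambda> \<longlongrightarrow> \<Lambda> s0) (at s0)"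
    using \<Lambda> by (simp add: continuous_on_eq_continuous_at isCont_def)
  have "isCont f (X s0, \<Lambda> s0)"
    using C1_map_continuous[OF f] by (simp add: continuous_on_eq_continuous_at)
  then have defect_lim: "((\<lambda>s. f (X s0, \<Lambda> s)) \<longlongrightarrow> X s0) (at s0)"
    using isCont_tendsto_compose[OF _ tendsto_Pair[OF tendsto_const \<Lambda>_lim]] fixed by metis
  show "isCont X s0"
  proof (rule isCont_if_connected_graph[OF conn \<open>0 < \<eta>\<close>])
    fix e :: real
    assume "0 < e"
    have "\<forall>\<^sub>F s in at s0. dist (\<Lambda> s) (\<Lambda> s0) < \<eta>"
      using tendstoD[OF \<Lambda>_lim \<open>0 < \<eta>\<close>] .
    moreover have "\<forall>\<^sub>F s in at s0. dist (f (X s0, \<Lambda> s)) (X s0) < c * e"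
      using tendstoD[OF defect_lim] \<open>0 < c\<close> \<open>0 < e\<close> by simp
    ultimately show "\<forall>\<^sub>F s in at s0. dist (X s) (X s0) < \<eta> \<longrightarrow> dist (X s) (X s0) < e"
    proof eventually_elim
      case (elim s)
      show ?case
      proof
        assume "dist (X s) (X s0) < \<eta>"
        then have "c * dist (X s) (X s0) < c * e"
          using defect[OF _ elim(1) fixed] elim(2) by linarith
        then show "dist (X s) (X s0) < e"
          using \<open>0 < c\<close> by simp
      qed
    qed
  qed
qed

lemma Dx_mult_vec:
  assumes "C1_map f"
  shows "Dx f x l *v v = frechet_derivative f (at (x, l)) (v, 0)"
proof -
  have "bounded_linear (\<lambda>v. frechet_derivative f (at (x, l)) (v, 0))"
    by (rule has_derivative_bounded_linear[OF C1_map_has_derivative_partial[OF assms]])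
  then show ?thesis
    unfolding Dx_def by (simp add: bounded_linear.linear matrix_works)
qed

lemma continuous_on_Dx:
  assumes "C1_map f"
  shows "continuous_on UNIV (\<lambda>p. Dx f (fst p) (snd p))"
proof -
  have "Dx f (fst p) (snd p) = (\<chi> i j. Blinfun (frechet_derivative f (at p)) (axis j 1, 0) $ i)"
    for p
    using bounded_linear_Blinfun_apply[OF C1_map_bounded_linear[OF assms]]
    by (simp add: Dx_def matrix_def)
  moreover have "continuous_on UNIV (\<lambda>p. Blinfun (frechet_derivative f (at p)))"
    using assms by (simp add: C1_map_def)
  then have
    "continuous_on UNIV (\<lambda>p. \<chi> i j. Blinfun (frechet_derivative f (at p)) (axis j 1, 0) $ i)"
    by (intro continuous_intros blinfun.continuous_on continuous_on_const)
  ultimately show ?thesis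
    by simp
qed

lemma parameter_shift_continuous: "parameter_shift \<Lambda> lm lp \<Longrightarrow> continuous_on UNIV \<Lambda>"
  unfolding parameter_shift_def
  by (blast intro: continuous_at_imp_continuous_on has_vector_derivative_continuous)

lemma stable_path_linearization:
  fixes f :: "(real^'l) \<times> (real^'m) \<Rightarrow> real^'l"
  assumes f: "C1_map f" and \<Lambda>: "parameter_shift \<Lambda> lm lp" and X: "stable_path f \<Lambda> lm lp X Xm Xp"
  shows "continuous_on UNIV (\<lambda>s. Dx f (X s) (\<Lambda> s))"
    and "((\<lambda>s. Dx f (X s) (\<Lambda> s)) \<longlongrightarrow> Dx f Xp lp) at_top"
    and "((\<lambda>s. Dx f (X s) (\<Lambda> s)) \<longlongrightarrow> Dx f Xm lm) at_bot"
proof -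
  have \<Lambda>_cont: "continuous_on UNIV \<Lambda>"
    using \<Lambda> by (rule parameter_shift_continuous)
  have "inj (\<lambda>v. v - frechet_derivative f (at (X s, \<Lambda> s)) (v, 0))" for s
    using inj_id_minus_if_spectral_radius_less_1[of "Dx f (X s) (\<Lambda> s)"] X
    by (simp add: stable_path_def Dx_mult_vec[OF f])
  then have X_cont: "continuous_on UNIV X"
    using continuous_on_fixed_point_curve[OF f \<Lambda>_cont] X by (simp add: stable_path_def)
  have Dx_cont: "isCont (\<lambda>p. Dx f (fst p) (snd p)) p" for p
    using continuous_on_Dx[OF f] continuous_on_eq_continuous_at[OF open_UNIV] by blast
  show "continuous_on UNIV (\<lambda>s. Dx f (X s) (\<Lambda> s))"
    using continuous_on_compose2[OF continuous_on_Dx[OF f] continuous_on_Pair[OF X_cont \<Lambda>_cont]]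
    by simp
  have X_lim: "(X \<longlongrightarrow> Xp) at_top" "(X \<longlongrightarrow> Xm) at_bot"
    using X by (simp_all add: stable_path_def)
  have \<Lambda>_lim: "(\<Lambda> \<longlongrightarrow> lp) at_top" "(\<Lambda> \<longlongrightarrow> lm) at_bot"
    using \<Lambda> unfolding parameter_shift_def by blast+
  show "((\<lambda>s. Dx f (X s) (\<Lambda> s)) \<longlongrightarrow> Dx f Xp lp) at_top"
    using isCont_tendsto_compose[OF Dx_cont tendsto_Pair[OF X_lim(1) \<Lambda>_lim(1)]] by simp
  show "((\<lambda>s. Dx f (X s) (\<Lambda> s)) \<longlongrightarrow> Dx f Xm lm) at_bot"
    using isCont_tendsto_compose[OF Dx_cont tendsto_Pair[OF X_lim(2) \<Lambda>_lim(2)]] by simp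
qed

theorem mainTheorem10:
  fixes f :: "(real^'l) \<times> (real^'m) \<Rightarrow> real^'l"
    and \<Lambda> :: "real \<Rightarrow> real^'m" and lm lp :: "real^'m"
    and X :: "real \<Rightarrow> real^'l" and Xm Xp :: "real^'l"
  assumes "C1_map f"
    and "parameter_shift \<Lambda> lm lp"
    and "stable_path f \<Lambda> lm lp X Xm Xp"
  shows "\<exists>N::nat. \<forall>s::real. \<forall>n\<ge>N.
           onorm (((*v) (Dx f (X s) (\<Lambda> s))) ^^ n) < 1/4"
proof -
  have "\<forall>\<^sub>F n in sequentially. \<forall>s. onorm ((*v) (matpow (Dx f (X s) (\<Lambda> s)) n)) < 1/4"
  proof (rule eventually_along_path_with_limits[OF stable_path_linearization[OF assms]])
    fix B
    assume "B \<in> insert (Dx f Xp lp) (insert (Dx f Xm lm) (range (\<lambda>s. Dx f (X s) (\<Lambda> s))))"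
    then have "spectral_radius_mat B < 1"
      using assms(3) by (auto simp: stable_path_def)
    then show "\<exists>U. open U \<and> B \<in> U \<and> (\<forall>\<^sub>F n in sequentially. \<forall>B'\<in>U. onorm ((*v) (matpow B' n)) < 1/4)"
      by (rule onorm_matpow_uniformly_small_near_if_spectral_radius_less_1) simp
  qed
  then show ?thesis
    unfolding eventually_sequentially matrix_vector_mul_matpow by blast
qed

end
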